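(* Let $A \in \mathbb{R}^{n\times n}$ be a singular hidden $Z$-matrix. Then $v(A) \not> 0$; that is, the value of the matrix game with payoff matrix $A$ is not positive.
   Context: All matrices are real, and vector inequalities are componentwise. A square matrix is a $Z$-matrix if all its off-diagonal entries are nonpositive. A matrix $A \in \mathbb{R}^{n\times n}$ is a hidden $Z$-matrix if there exist $Z$-matrices $X, Y \in \mathbb{R}^{n\times n}$ and vectors $r, s \in \mathbb{R}^n_+$ (nonnegative vectors) such that $AX = Y$ and $r^TX + s^TY > 0$. For a matrix $A=(a_{ij}) \in \mathbb{R}^{n\times n}$, $v(A)$ denotes the (von Neumann) minimax value of the two-person zero-sum game with payoff matrix $A$, i.e. the number $v$ for which there are probability vectors $x^\star, y^\star$ with $\sum_i x^\star_i a_{ij} \le v$ for all $j$ and $\sum_j a_{ij} y^\star_j \ge v$ for all $i$. Thus $v(A) > 0$ if and only if there exists $0 \neq x \geq 0$ with $Ax > 0$. *)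

theory Defs
  imports "HOL-Analysis.Analysis"
begin

definition Z_matrix :: "real^'n^'n \<Rightarrow> bool" where
  "Z_matrix A \<longleftrightarrow> (\<forall>i j. i \<noteq> j \<longrightarrow> A $ i $ j \<le> 0)"

text \<open>Strict positivity of a vector is spelled out entrywise, since the library order
  on \<open>real^'n\<close> has \<open>0 < x\<close> mean \<open>0 \<le> x\<close> and \<open>x \<noteq> 0\<close>.\<close>

definition hidden_Z_matrix :: "real^'n^'n \<Rightarrow> bool" where
  "hidden_Z_matrix A \<longleftrightarrow>
     (\<exists>X Y :: real^'n^'n. \<exists>r s :: real^'n.
        Z_matrix X \<and> Z_matrix Y \<and>
        (\<forall>i. 0 \<le> r $ i) \<and> (\<forall>i. 0 \<le> s $ i) \<and>
        A ** X = Y \<and>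
        (\<forall>j. 0 < (r v* X + s v* Y) $ j))"

definition prob_vector :: "real^'n \<Rightarrow> bool" where
  "prob_vector x \<longleftrightarrow> (\<forall>i. 0 \<le> x $ i) \<and> (\<Sum>i\<in>UNIV. x $ i) = 1"

text \<open>The row player (strategy \<open>x\<close>) minimizes and the column player (strategy \<open>y\<close>) maximizes.\<close>

definition is_game_value :: "real^'n^'n \<Rightarrow> real \<Rightarrow> bool" where
  "is_game_value A v \<longleftrightarrow>
     (\<exists>x y :: real^'n. prob_vector x \<and> prob_vector y \<and>
        (\<forall>j. (\<Sum>i\<in>UNIV. x $ i * A $ i $ j) \<le> v) \<and>
        (\<forall>i. (\<Sum>j\<in>UNIV. A $ i $ j * y $ j) \<ge> v))"

lemma is_game_value_unique:
  fixes A :: "real^'n^'n"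
  assumes "is_game_value A v" and "is_game_value A w"
  shows "v = w"
proof -
  have le: "b \<le> a" if "is_game_value A a" and "is_game_value A b" for a b
  proof -
    obtain x where x: "prob_vector x" "\<And>j. (\<Sum>i\<in>UNIV. x $ i * A $ i $ j) \<le> a"
      using \<open>is_game_value A a\<close> unfolding is_game_value_def by blast
    obtain y where y: "prob_vector y" "\<And>i. (\<Sum>j\<in>UNIV. A $ i $ j * y $ j) \<ge> b"
      using \<open>is_game_value A b\<close> unfolding is_game_value_def by blast
    have "b = (\<Sum>i\<in>UNIV. x $ i * b)"
      using x(1) by (simp add: prob_vector_def flip: sum_distrib_right)
    also have "\<dots> \<le> (\<Sum>i\<in>UNIV. x $ i * (\<Sum>j\<in>UNIV. A $ i $ j * y $ j))"
      using x(1) y(2) by (intro sum_mono mult_left_mono) (auto simp: prob_vector_def)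
    also have "\<dots> = (\<Sum>i\<in>UNIV. \<Sum>j\<in>UNIV. x $ i * A $ i $ j * y $ j)"
      by (simp add: sum_distrib_left mult.assoc)
    also have "\<dots> = (\<Sum>j\<in>UNIV. \<Sum>i\<in>UNIV. x $ i * A $ i $ j * y $ j)"
      by (rule sum.swap)
    also have "\<dots> = (\<Sum>j\<in>UNIV. (\<Sum>i\<in>UNIV. x $ i * A $ i $ j) * y $ j)"
      by (simp add: sum_distrib_right)
    also have "\<dots> \<le> (\<Sum>j\<in>UNIV. a * y $ j)"
      using x(2) y(1) by (intro sum_mono mult_right_mono) (auto simp: prob_vector_def)
    also have "\<dots> = a"
      using y(1) by (simp add: prob_vector_def flip: sum_distrib_left)
    finally show ?thesis .
  qed
  show ?thesis using le[OF assms] le[OF assms(2,1)] by simp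
qed

text \<open>Uniqueness is the lemma above; existence is von Neumann's minimax theorem.\<close>

definition game_value :: "real^'n^'n \<Rightarrow> real" where
  "game_value A = (THE v. is_game_value A v)"

end

theory Submission
  imports Defs
begin

text \<open>Write \<open>R\<close> and \<open>S\<close> for the diagonal matrices of \<open>r\<close> and \<open>s\<close>. The matrix
  \<open>K = R X + S Y = (R + S A) X\<close> is a \<open>Z\<close>-matrix with positive column sums, so it is
  injective and inverse-monotone; in particular \<open>X\<close> is invertible. If the value of the game
  were positive, an optimal column strategy \<open>y\<close> would satisfy \<open>A y > 0\<close>. With \<open>u = X\<^sup>-\<^sup>1 y\<close> we
  have \<open>K u = R y + S A y \<ge> 0\<close>, so \<open>u \<ge> 0\<close>, while \<open>Y u = A y > 0\<close>. Hence the \<open>Z\<close>-matrix \<open>Y\<close>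
  is invertible, and so is \<open>A = Y X\<^sup>-\<^sup>1\<close>.\<close>

section \<open>Inverse-monotone Z-matrices\<close>

lemma Z_matrix_transpose:
  fixes K :: "real^'n^'n"
  shows "Z_matrix K \<Longrightarrow> Z_matrix (transpose K)"
  by (simp add: Z_matrix_def transpose_def)

text \<open>If \<open>z\<close> had a nonempty set \<open>N\<close> of negative coordinates, the \<open>p\<close>-weighted sum of the
  coordinates of \<open>K z\<close> over \<open>N\<close> would be negative.\<close>

lemma Z_matrix_inverse_monotone:
  fixes K :: "real^'n^'n" and p z :: "real^'n"
  assumes Z: "Z_matrix K" and p: "\<And>i. 0 \<le> p $ i" and pK: "\<And>j. 0 < (p v* K) $ j"
    and Kz: "\<And>i. 0 \<le> (K *v z) $ i"
  shows "0 \<le> z $ i"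
proof (rule ccontr)
  assume i: "\<not> 0 \<le> z $ i"
  define N where "N = {j. z $ j < 0}"
  define q where "q j = (\<Sum>i\<in>N. p $ i * K $ i $ j)" for j
  have iN: "i \<in> N" using i by (simp add: N_def)
  \<comment> \<open>For \<open>j\<close> in \<open>N\<close>, the rows outside \<open>N\<close> meet
    column \<open>j\<close> only off the diagonal, so dropping their nonpositive terms keeps the
    weighted column sum positive.\<close>
  have q_pos: "0 < q j" if "j \<in> N" for j
  proof -
    have "(\<Sum>i\<in>UNIV. p $ i * K $ i $ j) = q j + (\<Sum>i\<in>-N. p $ i * K $ i $ j)"
      unfolding q_def by (simp add: sum.subset_diff[of N UNIV] Compl_eq_Diff_UNIV)
    moreover have "(\<Sum>i\<in>-N. p $ i * K $ i $ j) \<le> 0"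
      using that Z p by (intro sum_nonpos mult_nonneg_nonpos) (auto simp: Z_matrix_def, metis)
    moreover have "0 < (\<Sum>i\<in>UNIV. p $ i * K $ i $ j)"
      using pK[of j] by (simp add: vector_matrix_mult_def mult.commute)
    ultimately show ?thesis by linarith
  qed
  have q_nonpos: "q j \<le> 0" if "j \<notin> N" for j
    unfolding q_def using that Z p
    by (intro sum_nonpos mult_nonneg_nonpos) (auto simp: Z_matrix_def, metis)
  have "0 \<le> (\<Sum>i\<in>N. p $ i * (K *v z) $ i)"
    using p Kz by (intro sum_nonneg mult_nonneg_nonneg)
  also have "\<dots> = (\<Sum>i\<in>N. \<Sum>j\<in>UNIV. p $ i * K $ i $ j * z $ j)"
    by (simp add: matrix_vector_mult_def sum_distrib_left mult.assoc)
  also have "\<dots> = (\<Sum>j\<in>UNIV. q j * z $ j)"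
    unfolding q_def by (subst sum.swap) (simp add: sum_distrib_right)
  \<comment> \<open>On \<open>N\<close> the factor \<open>q j\<close> is positive and
    \<open>z $ j\<close> negative; off \<open>N\<close> the signs are reversed weakly. The term at
    \<open>i\<close> makes the inequality strict.\<close>
  also have "\<dots> < (\<Sum>j\<in>(UNIV::'n set). 0)"
  proof (rule sum_strict_mono_ex1)
    show "\<forall>j\<in>UNIV. q j * z $ j \<le> 0"
    proof
      fix j
      show "q j * z $ j \<le> 0"
      proof (cases "j \<in> N")
        case True
        then show ?thesis using q_pos[of j] by (simp add: N_def mult_le_0_iff)
      next
        case False
        then show ?thesis using q_nonpos[of j] by (simp add: N_def mult_le_0_iff)
      qed
    qed
    show "\<exists>j\<in>UNIV. q j * z $ j < 0"
      using iN q_pos[OF iN] by (auto simp: N_def mult_less_0_iff)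
  qed simp
  finally show False by simp
qed

text \<open>Inverse-monotonicity applies to both \<open>z\<close> and \<open>- z\<close> when
  \<open>z\<close> lies in the kernel, so the kernel is trivial.\<close>

lemma Z_matrix_invertible:
  fixes K :: "real^'n^'n" and p :: "real^'n"
  assumes "Z_matrix K" and "\<And>i. 0 \<le> p $ i" and "\<And>j. 0 < (p v* K) $ j"
  shows "invertible K"
proof -
  have "z = 0" if "K *v z = 0" for z
  proof -
    have "0 \<le> z $ i" "0 \<le> (- z) $ i" for i
      using that by (auto intro!: Z_matrix_inverse_monotone[OF assms, of _ i]
          simp del: vector_uminus_component simp: linear_neg[OF matrix_vector_mul_linear])
    then show ?thesis by (simp add: vec_eq_iff order_antisym)
  qed
  then show ?thesis
    by (auto simp: invertible_left_inverse matrix_left_invertible_ker)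
qed

lemma hidden_Z_matrix_invertible:
  fixes A :: "real^'n^'n" and y :: "real^'n"
  assumes "hidden_Z_matrix A" and y: "\<And>i. 0 \<le> y $ i" and Ay: "\<And>i. 0 < (A *v y) $ i"
  shows "invertible A"
proof -
  obtain X Y :: "real^'n^'n" and r s :: "real^'n" where
    XY: "Z_matrix X" "Z_matrix Y" "A ** X = Y"
    and rs: "\<And>i. 0 \<le> r $ i" "\<And>i. 0 \<le> s $ i"
    and pos: "\<And>j. 0 < (r v* X + s v* Y) $ j"
    using assms(1) unfolding hidden_Z_matrix_def by blast
  define K :: "real^'n^'n" where "K = (\<chi> i j. r $ i * X $ i $ j + s $ i * Y $ i $ j)"
  have KZ: "Z_matrix K"
    using XY rs by (auto simp: Z_matrix_def K_def intro!: add_nonpos_nonpos mult_nonneg_nonpos)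
  \<comment> \<open>The weights \<open>r\<close> and \<open>s\<close> are absorbed into
    \<open>K\<close>, so the all-ones vector can serve as \<open>p\<close>.\<close>
  have K_sums: "0 < (1 v* K) $ j" for j
    using pos[of j] by (simp add: K_def vector_matrix_mult_def sum.distrib mult.commute)
  have AX: "A *v (X *v z) = Y *v z" for z
    by (simp only: matrix_vector_mul_assoc XY(3))
  have K_apply: "(K *v z) $ i = r $ i * (X *v z) $ i + s $ i * (A *v (X *v z)) $ i" for z i
    unfolding AX
    by (simp add: K_def matrix_vector_mult_def sum_distrib_left algebra_simps sum.distrib)
  have invK: "invertible K"
    using Z_matrix_invertible[OF KZ _ K_sums] by simp
  have invX: "invertible X"
  proof -
    have "z = 0" if "X *v z = 0" for z
    proof -
      have "(K *v z) $ i = 0" for i unfolding K_apply that by simp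
      then have "K *v z = 0" by (simp add: vec_eq_iff)
      then show ?thesis
        using invK by (simp add: invertible_left_inverse matrix_left_invertible_ker)
    qed
    then show ?thesis
      by (auto simp: invertible_left_inverse matrix_left_invertible_ker)
  qed
  then obtain X' where X': "X ** X' = mat 1" "X' ** X = mat 1"
    by (auto simp: invertible_def)
  define u where "u = X' *v y"
  have Xu: "X *v u = y" by (simp add: u_def matrix_vector_mul_assoc X')
  have "0 \<le> (K *v u) $ i" for i
    using y[of i] Ay[of i] rs(1)[of i] rs(2)[of i] by (simp add: K_apply Xu)
  then have u: "0 \<le> u $ i" for i
    using Z_matrix_inverse_monotone[OF KZ _ K_sums] by simp
  have "Y *v u = A *v y"
    using AX[of u] Xu by simp
  \<comment> \<open>Passing to the transpose turns positivity of \<open>Y *v u\<close> into a column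
    condition, with \<open>u\<close> itself as the weight vector \<open>p\<close>.\<close>
  then have "0 < (u v* transpose Y) $ i" for i
    using Ay[of i] by simp
  then have "invertible (transpose Y)"
    using Z_matrix_invertible[OF Z_matrix_transpose[OF XY(2)] u] by blast
  then have invY: "invertible Y"
    by (simp add: invertible_det_nz)
  have "A = Y ** X'"
    by (metis XY(3) X'(1) matrix_mul_assoc matrix_mul_rid)
  moreover have "invertible X'" using X' by (auto simp: invertible_def)
  ultimately show ?thesis using invY by (simp add: invertible_mult)
qed

section \<open>The minimax theorem\<close>

lemma continuous_on_Max_image:
  fixes f :: "'i \<Rightarrow> 'a::topological_space \<Rightarrow> real"
  assumes "finite I" and "I \<noteq> {}" and "\<And>i. i \<in> I \<Longrightarrow> continuous_on S (f i)"
  shows "continuous_on S (\<lambda>x. Max ((\<lambda>i. f i x) ` I))"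
  using assms by (induction I rule: finite_ne_induct) (auto intro: continuous_on_max)

lemma compact_prob_vectors: "compact {x :: real^'n. prob_vector x}"
proof (rule compact_eq_bounded_closed[THEN iffD2], rule conjI)
  have "norm x \<le> 1" if "prob_vector x" for x :: "real^'n"
    using norm_le_l1_cart[of x] that by (simp add: prob_vector_def)
  then show "bounded {x :: real^'n. prob_vector x}"
    by (auto simp: bounded_iff)
  show "closed {x :: real^'n. prob_vector x}"
    unfolding prob_vector_def
    by (intro closed_Collect_conj closed_Collect_all closed_Collect_le closed_Collect_eq
        continuous_intros)
qed

lemma convex_prob_vectors: "convex {x :: real^'n. prob_vector x}"
  by (auto simp: convex_def prob_vector_def sum.distrib simp flip: sum_distrib_left)

lemma prob_vector_axis: "prob_vector (axis i 1 :: real^'n)"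
  by (simp add: prob_vector_def axis_def)

text \<open>The vector \<open>y\<close> is the normal of a hyperplane separating the convex set of all \<open>x v* B\<close>
  from the open negative orthant.\<close>

lemma game_alternative:
  fixes B :: "real^'n^'n"
  assumes B: "\<And>x. prob_vector x \<Longrightarrow> \<exists>j. 0 \<le> (x v* B) $ j"
  obtains y :: "real^'n" where "prob_vector y" "\<And>i. 0 \<le> (B *v y) $ i"
proof -
  define C where "C = (\<lambda>x. x v* B) ` {x. prob_vector x}"
  define S where "S = {z :: real^'n. \<forall>j. z $ j < 0}"
  have lin: "linear (\<lambda>x. x v* B)"
    using matrix_vector_mul_linear[of "transpose B"] by simp
  have "convex C"
    unfolding C_def by (rule convex_linear_image[OF lin convex_prob_vectors])
  moreover have "convex S"
  proof -
    have "S = (\<Inter>j. {z. z $ j < 0})" by (auto simp: S_def)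
    moreover have "convex {z :: real^'n. z $ j < 0}" for j
      using convex_halfspace_lt[of "axis j (1::real)" 0] by (simp add: inner_axis')
    ultimately show ?thesis by (simp add: convex_INT)
  qed
  moreover have "C \<noteq> {}" using prob_vector_axis by (auto simp: C_def)
  moreover have "- 1 \<in> S" by (simp add: S_def)
  then have "S \<noteq> {}" by blast
  moreover have "S \<inter> C = {}"
    using B unfolding S_def C_def disjoint_iff
    by (metis (mono_tags, lifting) imageE linorder_not_less mem_Collect_eq)
  ultimately obtain a b where a0: "a \<noteq> 0" and aS: "\<And>z. z \<in> S \<Longrightarrow> a \<bullet> z \<le> b"
    and aC: "\<And>z. z \<in> C \<Longrightarrow> b \<le> a \<bullet> z"
    using separating_hyperplane_sets[of S C] by blast
  define t where "t = (\<Sum>i\<in>UNIV. a $ i)"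
  \<comment> \<open>The test point has all entries \<open>- e\<close>, lowered by a further
    \<open>M\<close> at \<open>j\<close>. Large \<open>M\<close> will force
    \<open>a $ j \<ge> 0\<close>, small \<open>e\<close> will force
    \<open>b \<ge> 0\<close>.\<close>
  have S_bound: "- e * t - M * a $ j \<le> b" if "e > 0" "M \<ge> 0" for e M j
  proof -
    define z :: "real^'n" where "z = (\<chi> i. - e) - M *\<^sub>R axis j 1"
    have "z \<in> S" using that by (auto simp: S_def z_def axis_def add_pos_nonneg)
    moreover have "a \<bullet> z = - e * t - M * a $ j"
    proof -
      have "a \<bullet> (\<chi> i. - e) = - e * t"
        by (simp add: t_def inner_vec_def sum_negf sum_distrib_left mult.commute)
      then show ?thesis
        unfolding z_def inner_diff_right inner_scaleR_right by (simp add: inner_axis)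
    qed
    ultimately show ?thesis using aS by fastforce
  qed
  have a_nonneg: "0 \<le> a $ j" for j
  proof (rule ccontr)
    assume j: "\<not> 0 \<le> a $ j"
    \<comment> \<open>With \<open>e = 1\<close> this choice turns the bound into
      \<open>- t + \<bar>b\<bar> + \<bar>t\<bar> + 1 \<le> b\<close>, which is impossible.\<close>
    define M where "M = (\<bar>b\<bar> + \<bar>t\<bar> + 1) / (- a $ j)"
    have "M \<ge> 0" "M * a $ j = - (\<bar>b\<bar> + \<bar>t\<bar> + 1)"
      using j by (auto simp: M_def field_simps intro!: divide_nonneg_pos)
    then show False using S_bound[of 1 M j] by simp
  qed
  have b: "0 \<le> b"
  proof (rule field_le_epsilon)
    fix e :: real assume e: "e > 0"
    have t: "0 \<le> t" using a_nonneg by (simp add: t_def sum_nonneg)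
    \<comment> \<open>Only \<open>t \<ge> 0\<close> is known here, hence the denominator
      \<open>t + 1\<close>.\<close>
    have "- (e / (t + 1)) * t \<le> b" using S_bound[of "e / (t + 1)" 0] e t by simp
    moreover have "e / (t + 1) * t \<le> e" using e t by (simp add: field_simps)
    ultimately show "0 \<le> b + e" by linarith
  qed
  have t_pos: "t > 0"
  proof -
    have "t \<noteq> 0"
      using a0 a_nonneg by (auto simp: t_def sum_nonneg_eq_0_iff vec_eq_iff)
    moreover have "t \<ge> 0" using a_nonneg by (simp add: t_def sum_nonneg)
    ultimately show ?thesis by simp
  qed
  have Ba: "0 \<le> (B *v a) $ i" for i
  proof -
    \<comment> \<open>The pure strategy \<open>axis i 1\<close> places row \<open>i\<close> of
      \<open>B\<close> in \<open>C\<close>.\<close>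
    have "b \<le> a \<bullet> (axis i 1 v* B)"
      using aC prob_vector_axis by (auto simp: C_def)
    also have "\<dots> = (B *v a) $ i"
      using dot_lmul_matrix[of "axis i 1" B a] by (simp add: inner_commute inner_axis')
    finally show ?thesis using b by linarith
  qed
  define y where "y = (1 / t) *\<^sub>R a"
  have "prob_vector y"
    using a_nonneg t_pos by (simp add: prob_vector_def y_def t_def flip: sum_divide_distrib)
  moreover have "0 \<le> (B *v y) $ i" for i
    using Ba[of i] t_pos by (simp add: y_def matrix_vector_mult_scaleR)
  ultimately show ?thesis using that by blast
qed

text \<open>Compactness of the simplex yields an \<open>x\<close> minimizing the largest column
  payoff; subtracting that minimum \<open>v\<close> from all payoffs reduces the search for
  \<open>y\<close> to \<open>game_alternative\<close>.\<close>

theorem minimax: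
  fixes A :: "real^'n^'n"
  shows "\<exists>v. is_game_value A v"
proof -
  define f where "f x = Max (range (\<lambda>j. (x v* A) $ j))" for x
  have cont: "continuous_on {x. prob_vector x} f"
  proof -
    have "continuous_on UNIV (\<lambda>x. x v* A)"
      using matrix_vector_mult_linear_continuous_on[of UNIV "transpose A"] by simp
    then show ?thesis unfolding f_def
      by (intro continuous_on_Max_image continuous_intros) (auto intro: continuous_on_subset)
  qed
  obtain x where x: "prob_vector x" and min: "\<And>w. prob_vector w \<Longrightarrow> f x \<le> f w"
    using continuous_attains_inf[OF compact_prob_vectors _ cont] prob_vector_axis by blast
  define v where "v = f x"
  define B :: "real^'n^'n" where "B = (\<chi> i j. A $ i $ j - v)"
  \<comment> \<open>Since \<open>w\<close> sums to one, the shift lowers each column payoff by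
    exactly \<open>v\<close>, and the column attaining \<open>f w \<ge> v\<close> stays
    nonnegative.\<close>
  have "\<exists>j. 0 \<le> (w v* B) $ j" if w: "prob_vector w" for w
  proof -
    have "f w \<in> range (\<lambda>j. (w v* A) $ j)" unfolding f_def by (rule Max_in) auto
    then obtain j where "f w = (w v* A) $ j" by blast
    moreover have "(w v* B) $ j = (w v* A) $ j - v"
      using w by (simp add: B_def vector_matrix_mult_def prob_vector_def algebra_simps
          sum_subtractf flip: sum_distrib_left)
    ultimately show ?thesis using min[OF w] v_def by (intro exI[of _ j]) simp
  qed
  then obtain y where y: "prob_vector y" "\<And>i. 0 \<le> (B *v y) $ i"
    using game_alternative by blast
  have "(\<Sum>i\<in>UNIV. x $ i * A $ i $ j) \<le> v" for j
  proof -
    have "(x v* A) $ j \<le> v" unfolding v_def f_def by (rule Max_ge) auto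
    then show ?thesis by (simp add: vector_matrix_mult_def mult.commute)
  qed
  moreover have "v \<le> (\<Sum>j\<in>UNIV. A $ i $ j * y $ j)" for i
    using y(2)[of i] y(1)
    by (simp add: B_def matrix_vector_mult_def prob_vector_def left_diff_distrib
        sum_subtractf flip: sum_distrib_left)
  ultimately show ?thesis
    using x y(1) unfolding is_game_value_def by blast
qed

lemma is_game_value_game_value:
  fixes A :: "real^'n^'n"
  shows "is_game_value A (game_value A)"
  unfolding game_value_def using minimax[of A] is_game_value_unique
  by (metis (full_types) theI')

theorem theorem3p3:
  fixes A :: "real^'n^'n"
  assumes "hidden_Z_matrix A" and "\<not> invertible A"
  shows "\<not> game_value A > 0"
proof
  assume pos: "game_value A > 0"
  obtain y :: "real^'n" where y: "prob_vector y"
    "\<And>i. game_value A \<le> (\<Sum>j\<in>UNIV. A $ i $ j * y $ j)"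
    using is_game_value_game_value[of A] unfolding is_game_value_def by blast
  have "0 < (A *v y) $ i" for i
    using less_le_trans[OF pos y(2)[of i]] by (simp add: matrix_vector_mult_def)
  moreover have "0 \<le> y $ i" for i
    using y(1) by (simp add: prob_vector_def)
  ultimately show False
    using hidden_Z_matrix_invertible[OF assms(1)] assms(2) by blast
qed

end
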